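(* Let $b(u,v)=\int_\Omega (u-\alpha\mathcal{P}u)\,v\,d\mu$ and $l(v)=\int_\Omega f_0 v\,d\mu$ for $u,v\in L^2(\Omega)$, where $0<\alpha<1$, $f_0\in L^2(\Omega)$ is nonnegative, and $\mathcal{P}$ is a Perron-Frobenius operator with $\|\mathcal{P}f\|_{L^2}\le\|f\|_{L^2}$ for all $f\in L^2(\Omega)$. Then: (1) (Boundedness of $b$) $|b(u,v)|\le(1+\alpha)\|u\|_{L^2}\|v\|_{L^2}$ for all $u,v\in L^2(\Omega)$; (2) (Boundedness of $l$) $|l(v)|\le\|f_0\|_{L^2}\|v\|_{L^2}$ for all $v\in L^2(\Omega)$; (3) (Coercivity) $b(u,u)\ge(1-\alpha)\|u\|_{L^2}^2$ for all $u\in L^2(\Omega)$. Hence the problem: find $u\in L^2(\Omega)$ such that $b(u,v)=l(v)$ for all $v\in L^2(\Omega)$, has a unique solution.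
   Context: All functions are real-valued. $\Omega$ is a bounded (Borel) subset of $\mathbb{R}^d$, $d\ge1$, with Borel sigma-algebra $\mathcal{B}$ and Lebesgue measure $\mu$. $S:\Omega\to\Omega$ is a map (measurable and nonsingular, i.e. $\mu(S^{-1}(A))=0$ whenever $\mu(A)=0$, so that the following is well defined). The Perron-Frobenius operator associated with $S$ is the linear operator $\mathcal{P}:L^1(\Omega)\to L^1(\Omega)$ such that $\int_A\mathcal{P}f\,d\mu=\int_{S^{-1}(A)}f\,d\mu$ for all $A\in\mathcal{B}$ and $f\in L^1(\Omega)$. Since $\Omega$ is bounded, $L^2(\Omega)\subset L^1(\Omega)$; it is assumed that $\mathcal{P}$ is non-expansive on $L^2(\Omega)$, i.e. for all $f\in L^2(\Omega)$, $\mathcal{P}f\in L^2(\Omega)$ and $\|\mathcal{P}f\|_{L^2}\le\|f\|_{L^2}$. *)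

theory Defs
  imports "HOL-Analysis.Analysis"
begin

text \<open>
  Elements of \<open>L\<^sup>1\<close> and \<open>L\<^sup>2\<close> are represented by functions rather than by classes of functions
  modulo equality almost everywhere. Operators therefore act on representatives, and every
  identity between elements of these spaces is stated almost everywhere.
\<close>

definition lebesgue_on_borel :: "(real ^ 'n) set \<Rightarrow> (real ^ 'n) measure"
  where "lebesgue_on_borel \<Omega> = restrict_space lborel \<Omega>"

definition L1 :: "'a measure \<Rightarrow> ('a \<Rightarrow> real) set"
  where "L1 M = {f. integrable M f}"

definition L2 :: "'a measure \<Rightarrow> ('a \<Rightarrow> real) set"
  where "L2 M = {f \<in> borel_measurable M. integrable M (\<lambda>x. (f x)\<^sup>2)}"

definition L2_norm :: "'a measure \<Rightarrow> ('a \<Rightarrow> real) \<Rightarrow> real"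
  where "L2_norm M f = sqrt (LINT x|M. (f x)\<^sup>2)"

definition nonsingular_map :: "'a measure \<Rightarrow> ('a \<Rightarrow> 'a) \<Rightarrow> bool"
  where "nonsingular_map M S \<longleftrightarrow>
    S \<in> measurable M M \<and>
    (\<forall>A\<in>sets M. emeasure M A = 0 \<longrightarrow> emeasure M (S -` A \<inter> space M) = 0)"

definition linear_operator_L1 :: "'a measure \<Rightarrow> (('a \<Rightarrow> real) \<Rightarrow> 'a \<Rightarrow> real) \<Rightarrow> bool"
  where "linear_operator_L1 M P \<longleftrightarrow>
    (\<forall>f\<in>L1 M. P f \<in> L1 M) \<and>
    (\<forall>f\<in>L1 M. \<forall>g\<in>L1 M. (AE x in M. f x = g x) \<longrightarrow> (AE x in M. P f x = P g x)) \<and>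
    (\<forall>f\<in>L1 M. \<forall>g\<in>L1 M. AE x in M. P (\<lambda>y. f y + g y) x = P f x + P g x) \<and>
    (\<forall>f\<in>L1 M. \<forall>c. AE x in M. P (\<lambda>y. c * f y) x = c * P f x)"

text \<open>
  The integral identity determines \<open>P f\<close> almost everywhere, so compatibility with equality
  almost everywhere and linearity are in fact consequences of it. \<open>P\<close> is unconstrained outside
  \<open>L\<^sup>1\<close>.
\<close>

definition perron_frobenius_operator ::
    "'a measure \<Rightarrow> ('a \<Rightarrow> 'a) \<Rightarrow> (('a \<Rightarrow> real) \<Rightarrow> 'a \<Rightarrow> real) \<Rightarrow> bool"
  where "perron_frobenius_operator M S P \<longleftrightarrow>
    linear_operator_L1 M P \<and>
    (\<forall>f\<in>L1 M. \<forall>A\<in>sets M. (LINT x:A|M. P f x) = (LINT x:(S -` A \<inter> space M)|M. f x))"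

definition nonexpansive_L2 :: "'a measure \<Rightarrow> (('a \<Rightarrow> real) \<Rightarrow> 'a \<Rightarrow> real) \<Rightarrow> bool"
  where "nonexpansive_L2 M P \<longleftrightarrow> (\<forall>f\<in>L2 M. P f \<in> L2 M \<and> L2_norm M (P f) \<le> L2_norm M f)"

definition form_b ::
    "'a measure \<Rightarrow> (('a \<Rightarrow> real) \<Rightarrow> 'a \<Rightarrow> real) \<Rightarrow> real \<Rightarrow> ('a \<Rightarrow> real) \<Rightarrow> ('a \<Rightarrow> real) \<Rightarrow> real"
  where "form_b M P \<alpha> u v = (LINT x|M. (u x - \<alpha> * P u x) * v x)"

definition form_l :: "'a measure \<Rightarrow> ('a \<Rightarrow> real) \<Rightarrow> ('a \<Rightarrow> real) \<Rightarrow> real"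
  where "form_l M f0 v = (LINT x|M. f0 x * v x)"

definition weak_solution ::
    "'a measure \<Rightarrow> (('a \<Rightarrow> real) \<Rightarrow> 'a \<Rightarrow> real) \<Rightarrow> real \<Rightarrow> ('a \<Rightarrow> real) \<Rightarrow> ('a \<Rightarrow> real) \<Rightarrow> bool"
  where "weak_solution M P \<alpha> f0 u \<longleftrightarrow>
    u \<in> L2 M \<and> (\<forall>v\<in>L2 M. form_b M P \<alpha> u v = form_l M f0 v)"

end

theory Submission
  imports Defs
begin

text \<open>
  The bounds are Cauchy-Schwarz together with \<open>\<parallel>P u\<parallel> \<le> \<parallel>u\<parallel>\<close>, and uniqueness follows from coercivity.
  Instead of invoking Lax-Milgram, which would need the completeness of \<open>L\<^sup>2\<close>, the solution is
  written down as the Neumann series \<open>u = (\<Sum>k. \<alpha>\<^sup>k P\<^sup>k f\<^sub>0)\<close>. It converges absolutely almost everywhere and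
  in \<open>L\<^sup>1\<close>, lies in \<open>L\<^sup>2\<close> because \<open>(1 - \<alpha>) u\<^sup>2 \<le> (\<Sum>k. \<alpha>\<^sup>k (P\<^sup>k f\<^sub>0)\<^sup>2)\<close> pointwise, and integrating it
  term by term over preimages \<open>S\<^sup>-\<^sup>1(A)\<close> gives \<open>u - \<alpha> P u = f\<^sub>0\<close>.
\<close>

section \<open>Square-integrable functions and Cauchy-Schwarz\<close>

lemma L2_measurable: "f \<in> L2 M \<Longrightarrow> f \<in> borel_measurable M"
  and L2_integrable_square: "f \<in> L2 M \<Longrightarrow> integrable M (\<lambda>x. (f x)\<^sup>2)"
  by (simp_all add: L2_def)

lemma L2_norm_nonneg: "0 \<le> L2_norm M f"
  by (simp add: L2_norm_def)

lemma L2_norm_square: "(L2_norm M f)\<^sup>2 = (LINT x|M. (f x)\<^sup>2)"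
  by (simp add: L2_norm_def)

lemma L2_mult_integrable:
  assumes "f \<in> L2 M" "g \<in> L2 M"
  shows "integrable M (\<lambda>x. f x * g x)"
proof (rule Bochner_Integration.integrable_bound)
  show "integrable M (\<lambda>x. (f x)\<^sup>2 + (g x)\<^sup>2)"
    using assms by (simp add: L2_integrable_square)
  show "(\<lambda>x. f x * g x) \<in> borel_measurable M"
    using assms[THEN L2_measurable] by simp
  have "\<bar>a * b\<bar> \<le> a\<^sup>2 + b\<^sup>2" for a b :: real
  proof -
    have "2 * (\<bar>a\<bar> * \<bar>b\<bar>) \<le> a\<^sup>2 + b\<^sup>2"
      using sum_squares_bound[of "\<bar>a\<bar>" "\<bar>b\<bar>"] by (simp add: mult.assoc)
    moreover have "0 \<le> \<bar>a\<bar> * \<bar>b\<bar>" by simp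
    ultimately show ?thesis unfolding abs_mult by linarith
  qed
  then show "AE x in M. norm (f x * g x) \<le> norm ((f x)\<^sup>2 + (g x)\<^sup>2)"
    by simp
qed

lemma L2_add:
  assumes "f \<in> L2 M" "g \<in> L2 M"
  shows "(\<lambda>x. f x + g x) \<in> L2 M"
  using assms L2_mult_integrable[OF assms]
  by (auto simp: L2_def power2_sum mult.assoc)

lemma L2_cmult: "f \<in> L2 M \<Longrightarrow> (\<lambda>x. c * f x) \<in> L2 M"
  by (auto simp: L2_def power_mult_distrib)

lemma L2_norm_eq_0_AE:
  assumes "f \<in> L2 M" "L2_norm M f = 0"
  shows "AE x in M. f x = 0"
proof -
  have "(LINT x|M. (f x)\<^sup>2) = 0"
    using assms(2) L2_norm_square[of M f] by simp
  then show ?thesis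
    using integral_nonneg_eq_0_iff_AE[OF L2_integrable_square[OF assms(1)]] by simp
qed

text \<open>With \<open>a\<close> and \<open>b\<close> the two norms, the square of
  \<open>b * f - a * g\<close> has nonnegative integral; expanding it and cancelling
  \<open>a * b\<close> gives the bound. A vanishing norm forbids the cancellation, but then the
  product is zero almost everywhere.\<close>

lemma L2_Cauchy_Schwarz_le:
  assumes f: "f \<in> L2 M" and g: "g \<in> L2 M"
  shows "(LINT x|M. f x * g x) \<le> L2_norm M f * L2_norm M g"
proof (cases "L2_norm M f = 0 \<or> L2_norm M g = 0")
  case True
  then have "AE x in M. f x * g x = 0"
    using L2_norm_eq_0_AE[OF f] L2_norm_eq_0_AE[OF g] by auto
  then have "(LINT x|M. f x * g x) = 0"
    by (rule integral_eq_zero_AE)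
  then show ?thesis by (simp add: L2_norm_nonneg)
next
  case False
  define a b where "a = L2_norm M f" and "b = L2_norm M g"
  have pos: "0 < a * b"
    using False L2_norm_nonneg[of M f] L2_norm_nonneg[of M g] by (simp add: a_def b_def)
  have fg: "integrable M (\<lambda>x. f x * g x)" by (rule L2_mult_integrable[OF f g])
  have "0 \<le> (LINT x|M. (b * f x - a * g x)\<^sup>2)" by simp
  also have "\<dots> = (LINT x|M. b\<^sup>2 * (f x)\<^sup>2 + a\<^sup>2 * (g x)\<^sup>2 - 2 * (a * b) * (f x * g x))"
    by (intro Bochner_Integration.integral_cong) (auto simp: power2_eq_square algebra_simps)
  also have "\<dots> = b\<^sup>2 * a\<^sup>2 + a\<^sup>2 * b\<^sup>2 - 2 * (a * b) * (LINT x|M. f x * g x)"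
    using f g fg by (simp add: L2_integrable_square a_def b_def L2_norm_square)
  finally have "(a * b) * (LINT x|M. f x * g x) \<le> (a * b) * (a * b)"
    by (simp add: power2_eq_square algebra_simps)
  then show ?thesis
    using pos unfolding a_def b_def by (rule mult_left_le_imp_le)
qed

lemma L2_Cauchy_Schwarz:
  assumes "f \<in> L2 M" "g \<in> L2 M"
  shows "\<bar>LINT x|M. f x * g x\<bar> \<le> L2_norm M f * L2_norm M g"
proof -
  \<comment> \<open>Changing the sign of \<open>f\<close> keeps its norm, so the one-sided bound
    also controls the negated integral.\<close>
  have "L2_norm M (\<lambda>x. (- 1) * f x) = L2_norm M f"
    by (simp add: L2_norm_def)
  then show ?thesis
    using L2_Cauchy_Schwarz_le[OF assms] L2_Cauchy_Schwarz_le[OF L2_cmult[OF assms(1), of "- 1"] assms(2)]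
    by (simp add: abs_le_iff)
qed

text \<open>The constant 1 is square integrable on a finite measure space, so \<open>f\<close> is a
  product of two square-integrable functions.\<close>

lemma (in finite_measure) L2_integrable:
  assumes "f \<in> L2 M"
  shows "integrable M f"
  using L2_mult_integrable[OF assms, of "\<lambda>_. 1"] by (simp add: L2_def)

section \<open>Two facts about series of functions and numbers\<close>

text \<open>By monotone convergence the pointwise sum, taken in the extended nonnegative reals, has
  finite integral and is therefore finite almost everywhere.\<close>

lemma AE_summable_if_summable_integral:
  fixes F :: "nat \<Rightarrow> 'a \<Rightarrow> real"
  assumes F: "\<And>k. integrable M (F k)" and nonneg: "\<And>k x. 0 \<le> F k x"
    and sums: "summable (\<lambda>k. LINT x|M. F k x)"
  shows "AE x in M. summable (\<lambda>k. F k x)"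
proof -
  note [measurable] = borel_measurable_integrable[OF F]
  have "(\<integral>\<^sup>+ x. (\<Sum>k. ennreal (F k x)) \<partial>M) = (\<Sum>k. \<integral>\<^sup>+ x. ennreal (F k x) \<partial>M)"
    by (intro nn_integral_suminf) measurable
  also have "\<dots> = (\<Sum>k. ennreal (LINT x|M. F k x))"
    using F nonneg by (simp add: nn_integral_eq_integral)
  also have "\<dots> \<noteq> \<infinity>"
    using sums nonneg by (simp add: ennreal_suminf_neq_top)
  finally have "AE x in M. (\<Sum>k. ennreal (F k x)) \<noteq> \<infinity>"
    by (intro nn_integral_PInf_AE) auto
  then show ?thesis
    by eventually_elim (use nonneg in \<open>auto intro: summable_suminf_not_top\<close>)
qed

text \<open>This is Jensen's inequality for the square: the weights (1 - \<alpha>) \<alpha>^k form a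
  probability distribution on the naturals, and the variance of \<open>g\<close> under it is
  nonnegative.\<close>

lemma weighted_suminf_square_le:
  fixes g :: "nat \<Rightarrow> real"
  assumes "0 \<le> \<alpha>" "\<alpha> < 1"
    and g: "summable (\<lambda>k. \<alpha> ^ k * g k)" and g2: "summable (\<lambda>k. \<alpha> ^ k * (g k)\<^sup>2)"
  shows "(1 - \<alpha>) * (\<Sum>k. \<alpha> ^ k * g k)\<^sup>2 \<le> (\<Sum>k. \<alpha> ^ k * (g k)\<^sup>2)"
proof -
  define u where "u = (\<Sum>k. \<alpha> ^ k * g k)"
  \<comment> \<open>The mean of \<open>g\<close> under the normalized weights; expanding the squared
    deviations from it gives the variance.\<close>
  define m where "m = (1 - \<alpha>) * u"
  have geo: "(\<lambda>k. \<alpha> ^ k) sums (1 / (1 - \<alpha>))"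
    using assms by (intro geometric_sums) simp
  have "(\<lambda>k. \<alpha> ^ k * (g k)\<^sup>2 - 2 * m * (\<alpha> ^ k * g k) + m\<^sup>2 * \<alpha> ^ k)
      sums ((\<Sum>k. \<alpha> ^ k * (g k)\<^sup>2) - 2 * m * u + m\<^sup>2 * (1 / (1 - \<alpha>)))"
    unfolding u_def
    by (intro sums_add sums_diff sums_mult geo summable_sums g g2)
  also have "(\<lambda>k. \<alpha> ^ k * (g k)\<^sup>2 - 2 * m * (\<alpha> ^ k * g k) + m\<^sup>2 * \<alpha> ^ k)
      = (\<lambda>k. \<alpha> ^ k * (g k - m)\<^sup>2)"
    by (auto simp: power2_eq_square algebra_simps)
  finally have "0 \<le> (\<Sum>k. \<alpha> ^ k * (g k)\<^sup>2) - 2 * m * u + m\<^sup>2 * (1 / (1 - \<alpha>))"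
    by (rule sums_le[OF _ sums_zero, rotated]) (simp add: assms(1))
  also have "\<dots> = (\<Sum>k. \<alpha> ^ k * (g k)\<^sup>2) - (1 - \<alpha>) * u\<^sup>2"
    using assms(2) by (simp add: m_def power2_eq_square field_simps)
  finally show ?thesis by (simp add: u_def)
qed

section \<open>Boundedness, coercivity and uniqueness\<close>

text \<open>The domain is abstracted to a finite measure space. Finiteness makes square-integrable
  functions integrable, so the integral identity and the linearity of \<open>P\<close> apply to
  them.\<close>

locale nonexpansive_perron_frobenius = finite_measure M
  for M :: "'a measure" +
  fixes S :: "'a \<Rightarrow> 'a" and P :: "('a \<Rightarrow> real) \<Rightarrow> 'a \<Rightarrow> real"
  assumes nonsingular: "nonsingular_map M S"
    and perron_frobenius: "perron_frobenius_operator M S P"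
    and nonexpansive: "nonexpansive_L2 M P"
begin

lemma P_L2: "f \<in> L2 M \<Longrightarrow> P f \<in> L2 M"
  and L2_norm_P: "f \<in> L2 M \<Longrightarrow> L2_norm M (P f) \<le> L2_norm M f"
  using nonexpansive by (auto simp: nonexpansive_L2_def)

lemma P_integrable: "integrable M f \<Longrightarrow> integrable M (P f)"
  using perron_frobenius by (auto simp: perron_frobenius_operator_def linear_operator_L1_def L1_def)

lemma set_integral_P:
  "integrable M f \<Longrightarrow> A \<in> sets M \<Longrightarrow> (LINT x:A|M. P f x) = (LINT x:(S -` A \<inter> space M)|M. f x)"
  using perron_frobenius by (auto simp: perron_frobenius_operator_def L1_def)

lemma vimage_S_sets: "A \<in> sets M \<Longrightarrow> S -` A \<inter> space M \<in> sets M"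
  using nonsingular by (auto simp: nonsingular_map_def)

lemma P_add_AE:
  "integrable M f \<Longrightarrow> integrable M g \<Longrightarrow> AE x in M. P (\<lambda>y. f y + g y) x = P f x + P g x"
  and P_cmult_AE: "integrable M f \<Longrightarrow> AE x in M. P (\<lambda>y. c * f y) x = c * P f x"
  using perron_frobenius
  by (simp_all add: perron_frobenius_operator_def linear_operator_L1_def L1_def)

lemma P_diff_AE:
  assumes f: "integrable M f" and g: "integrable M g"
  shows "AE x in M. P (\<lambda>y. f y + (- 1) * g y) x = P f x - P g x"
  using P_add_AE[OF f integrable_mult_right[OF g, of "- 1"]] P_cmult_AE[OF g, of "- 1"]
  by eventually_elim simp

lemma residual_L2:
  assumes "u \<in> L2 M"
  shows "(\<lambda>x. u x - \<alpha> * P u x) \<in> L2 M"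
  using L2_add[OF assms L2_cmult[OF P_L2[OF assms], of "- \<alpha>"]] by simp

lemma form_b_eq:
  assumes u: "u \<in> L2 M" and v: "v \<in> L2 M"
  shows "form_b M P \<alpha> u v = (LINT x|M. u x * v x) - \<alpha> * (LINT x|M. P u x * v x)"
  using L2_mult_integrable[OF u v] L2_mult_integrable[OF P_L2[OF u] v]
  by (simp add: form_b_def left_diff_distrib mult.assoc)

text \<open>The only estimate of the \<open>P\<close> term: it serves both the boundedness of the
  form and, with \<open>v = u\<close>, its coercivity.\<close>

lemma abs_integral_P_mult_le:
  assumes u: "u \<in> L2 M" and v: "v \<in> L2 M"
  shows "\<bar>LINT x|M. P u x * v x\<bar> \<le> L2_norm M u * L2_norm M v"
  using L2_Cauchy_Schwarz[OF P_L2[OF u] v] mult_right_mono[OF L2_norm_P[OF u] L2_norm_nonneg[of M v]]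
  by linarith

lemma form_b_bounded:
  assumes u: "u \<in> L2 M" and v: "v \<in> L2 M" and "0 \<le> \<alpha>"
  shows "\<bar>form_b M P \<alpha> u v\<bar> \<le> (1 + \<alpha>) * L2_norm M u * L2_norm M v"
proof -
  have "\<bar>form_b M P \<alpha> u v\<bar> \<le> \<bar>LINT x|M. u x * v x\<bar> + \<alpha> * \<bar>LINT x|M. P u x * v x\<bar>"
    unfolding form_b_eq[OF u v] using \<open>0 \<le> \<alpha>\<close>
      abs_triangle_ineq4[of "LINT x|M. u x * v x" "\<alpha> * (LINT x|M. P u x * v x)"]
    by (simp add: abs_mult)
  also have "\<dots> \<le> L2_norm M u * L2_norm M v + \<alpha> * (L2_norm M u * L2_norm M v)"
    by (intro add_mono mult_left_mono L2_Cauchy_Schwarz abs_integral_P_mult_le u v \<open>0 \<le> \<alpha>\<close>)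
  finally show ?thesis by (simp add: algebra_simps)
qed

lemma form_b_coercive:
  assumes u: "u \<in> L2 M" and "0 \<le> \<alpha>"
  shows "(1 - \<alpha>) * (L2_norm M u)\<^sup>2 \<le> form_b M P \<alpha> u u"
proof -
  have "\<alpha> * (LINT x|M. P u x * u x) \<le> \<alpha> * (L2_norm M u * L2_norm M u)"
    using abs_integral_P_mult_le[OF u u] \<open>0 \<le> \<alpha>\<close> by (intro mult_left_mono) auto
  moreover have "(LINT x|M. u x * u x) = (L2_norm M u)\<^sup>2"
    by (simp add: L2_norm_square flip: power2_eq_square)
  ultimately show ?thesis
    unfolding form_b_eq[OF u u] by (simp add: power2_eq_square algebra_simps)
qed

text \<open>Testing both equations with the difference \<open>d\<close> of the solutions makes the
  form vanish at \<open>d\<close>, and coercivity forces \<open>d\<close> to have norm zero.\<close>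

lemma weak_solution_unique:
  assumes "0 \<le> \<alpha>" "\<alpha> < 1"
    and u: "weak_solution M P \<alpha> f0 u" and w: "weak_solution M P \<alpha> f0 w"
  shows "AE x in M. w x = u x"
proof -
  have uL: "u \<in> L2 M" and wL: "w \<in> L2 M"
    using u w by (auto simp: weak_solution_def)
  \<comment> \<open>Written as a sum with the factor -1 to match \<open>P_diff_AE\<close>.\<close>
  define d where "d = (\<lambda>x. w x + (- 1) * u x)"
  have dL: "d \<in> L2 M"
    unfolding d_def by (intro L2_add L2_cmult uL wL)
  have "AE x in M. P d x = P w x - P u x"
    unfolding d_def by (intro P_diff_AE L2_integrable uL wL)
  moreover have d_eq: "d x = w x - u x" for x by (simp add: d_def)
  ultimately have "AE x in M. (d x - \<alpha> * P d x) * d x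
      = (w x - \<alpha> * P w x) * d x - (u x - \<alpha> * P u x) * d x"
    by (elim AE_mp) (simp add: d_eq left_diff_distrib right_diff_distrib)
  \<comment> \<open>Since \<open>P\<close> is linear only up to null sets, linearity of the form in
    its first argument is obtained by an almost-everywhere change of integrand.\<close>
  then have "form_b M P \<alpha> d d
      = (LINT x|M. (w x - \<alpha> * P w x) * d x - (u x - \<alpha> * P u x) * d x)"
    unfolding form_b_def
    using P_L2[OF dL, THEN L2_measurable] P_L2[OF wL, THEN L2_measurable]
      P_L2[OF uL, THEN L2_measurable] dL[THEN L2_measurable]
      uL[THEN L2_measurable] wL[THEN L2_measurable]
    by (intro integral_cong_AE) auto
  also have "\<dots> = form_b M P \<alpha> w d - form_b M P \<alpha> u d"
    unfolding form_b_def
    by (intro Bochner_Integration.integral_diff L2_mult_integrable residual_L2 uL wL dL)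
  also have "\<dots> = 0"
    using u w dL by (simp add: weak_solution_def)
  finally have "(1 - \<alpha>) * (L2_norm M d)\<^sup>2 \<le> 0"
    using form_b_coercive[OF dL \<open>0 \<le> \<alpha>\<close>] by simp
  then have "L2_norm M d = 0"
    using \<open>\<alpha> < 1\<close> by (simp add: mult_le_0_iff)
  from L2_norm_eq_0_AE[OF dL this] show ?thesis
    by eventually_elim (simp add: d_def)
qed

section \<open>Existence by the Neumann series\<close>

lemma P_iterate_L2: "f \<in> L2 M \<Longrightarrow> (P ^^ k) f \<in> L2 M"
  by (induction k) (simp_all add: P_L2)

lemma L2_norm_P_iterate: "f \<in> L2 M \<Longrightarrow> L2_norm M ((P ^^ k) f) \<le> L2_norm M f"
proof (induction k)
  case (Suc k)
  then show ?case using L2_norm_P[OF P_iterate_L2[of f k]] by simp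
qed simp

text \<open>The equation is first proved almost everywhere by comparing integrals over all
  measurable sets, and then tested with \<open>v\<close>. Thus \<open>P\<close> itself is never
  exchanged with the infinite sum; only integrals are.\<close>

lemma weak_solution_exists:
  assumes \<alpha>: "0 \<le> \<alpha>" "\<alpha> < 1" and f0: "f0 \<in> L2 M"
  shows "\<exists>u. weak_solution M P \<alpha> f0 u"
proof -
  define g where "g = (\<lambda>k. (P ^^ k) f0)"
  define c where "c = (L2_norm M f0)\<^sup>2"
  \<comment> \<open>Where the series diverges, \<open>suminf\<close> is an unspecified real; this
    concerns only a null set.\<close>
  define u where "u = (\<lambda>x. \<Sum>k. \<alpha> ^ k * g k x)"
  have gL: "g k \<in> L2 M" for k
    unfolding g_def by (rule P_iterate_L2[OF f0])
  note [measurable] = gL[THEN L2_measurable]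
  have g_int: "integrable M (g k)" for k by (rule L2_integrable[OF gL])
  have g2_int: "integrable M (\<lambda>x. (g k x)\<^sup>2)" for k by (rule L2_integrable_square[OF gL])
  have geo: "summable (\<lambda>k. \<alpha> ^ k)" using \<alpha> by (simp add: summable_geometric)
  have g2_bound: "(LINT x|M. (g k x)\<^sup>2) \<le> c" for k
    unfolding L2_norm_square[symmetric] c_def g_def
    by (intro power_mono L2_norm_P_iterate f0 L2_norm_nonneg)
  \<comment> \<open>Nonexpansiveness bounds every iterate by the norm of \<open>f0\<close>, so a
    geometric series dominates.\<close>
  have sum_g2_integral: "summable (\<lambda>k. LINT x|M. \<alpha> ^ k * (g k x)\<^sup>2)"
  proof (rule summable_comparison_test'[OF summable_mult2[OF geo, of c], of 0])
    show "norm (LINT x|M. \<alpha> ^ k * (g k x)\<^sup>2) \<le> \<alpha> ^ k * c" for k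
      using g2_bound[of k] \<alpha> by (simp add: abs_mult mult_left_mono)
  qed
  have sum_g2: "AE x in M. summable (\<lambda>k. \<alpha> ^ k * (g k x)\<^sup>2)"
    using \<alpha> g2_int sum_g2_integral by (intro AE_summable_if_summable_integral) auto
  \<comment> \<open>Transfers control of squares to control of absolute values; the summand 1 costs
    a geometric series pointwise and the total mass after integration.\<close>
  have abs_le: "\<bar>y\<bar> \<le> 1 + y\<^sup>2" for y :: real
    using sum_squares_bound[of "\<bar>y\<bar>" 1] by simp
  have sum_abs_g: "AE x in M. summable (\<lambda>k. norm (\<alpha> ^ k * g k x))"
    using sum_g2
  proof eventually_elim
    case (elim x)
    show ?case
    proof (rule summable_comparison_test'[OF summable_add[OF geo elim], of 0])
      show "norm (norm (\<alpha> ^ k * g k x)) \<le> \<alpha> ^ k + \<alpha> ^ k * (g k x)\<^sup>2" for k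
        using mult_left_mono[OF abs_le[of "g k x"], of "\<alpha> ^ k"] \<alpha> by (simp add: abs_mult algebra_simps)
    qed
  qed
  have sum_g_integral: "summable (\<lambda>k. LINT x|M. norm (\<alpha> ^ k * g k x))"
  proof (rule summable_comparison_test'[OF summable_mult2[OF geo, of "measure M (space M) + c"], of 0])
    fix k
    have "(LINT x|M. \<bar>g k x\<bar>) \<le> (LINT x|M. 1 + (g k x)\<^sup>2)"
      using g_int g2_int abs_le by (intro integral_mono) auto
    also have "\<dots> \<le> measure M (space M) + c"
      using g2_int[of k] g2_bound[of k] by simp
    finally show "norm (LINT x|M. norm (\<alpha> ^ k * g k x)) \<le> \<alpha> ^ k * (measure M (space M) + c)"
      using \<alpha> by (simp add: abs_mult mult_left_mono)
  qed
  have u_int: "integrable M u"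
    unfolding u_def using g_int sum_abs_g sum_g_integral by (intro integrable_suminf) auto
  have uL: "u \<in> L2 M"
  proof -
    have "integrable M (\<lambda>x. (u x)\<^sup>2)"
    proof (rule Bochner_Integration.integrable_bound)
      show "integrable M (\<lambda>x. (\<Sum>k. \<alpha> ^ k * (g k x)\<^sup>2) / (1 - \<alpha>))"
        using g2_int sum_g2 sum_g2_integral \<alpha>
        by (intro integrable_divide_zero integrable_suminf) (auto simp: abs_mult)
      show "AE x in M. norm ((u x)\<^sup>2) \<le> norm ((\<Sum>k. \<alpha> ^ k * (g k x)\<^sup>2) / (1 - \<alpha>))"
        using sum_g2 sum_abs_g
      proof eventually_elim
        case (elim x)
        have "(1 - \<alpha>) * (u x)\<^sup>2 \<le> (\<Sum>k. \<alpha> ^ k * (g k x)\<^sup>2)"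
          unfolding u_def using elim \<alpha>
          by (intro weighted_suminf_square_le summable_norm_cancel[of "\<lambda>k. \<alpha> ^ k * g k x"]) auto
        then have "(u x)\<^sup>2 \<le> (\<Sum>k. \<alpha> ^ k * (g k x)\<^sup>2) / (1 - \<alpha>)"
          using \<alpha> by (simp add: field_simps)
        then show ?case by (simp del: abs_divide)
      qed
    qed (use u_int in auto)
    then show ?thesis using u_int by (simp add: L2_def)
  qed
  \<comment> \<open>Stated for arbitrary \<open>B\<close> because it is needed both for a set
    \<open>A\<close> and for its preimage under \<open>S\<close>.\<close>
  have term_by_term: "(\<lambda>k. \<alpha> ^ k * (LINT x:B|M. g k x)) sums (LINT x:B|M. u x)"
    if B: "B \<in> sets M" for B
  proof -
    have sB: "AE x in M. summable (\<lambda>k. norm (indicator B x * (\<alpha> ^ k * g k x)))"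
      using sum_abs_g by eventually_elim (auto simp: indicator_def)
    have iB: "integrable M (\<lambda>x. indicator B x * (\<alpha> ^ k * g k x))" for k
      using integrable_mult_indicator[OF B integrable_mult_right[OF g_int[of k], of "\<alpha> ^ k"]] by simp
    have "summable (\<lambda>k. LINT x|M. norm (indicator B x * (\<alpha> ^ k * g k x)))"
    proof (rule summable_comparison_test'[OF sum_g_integral, of 0])
      show "norm (LINT x|M. norm (indicator B x * (\<alpha> ^ k * g k x)))
          \<le> (LINT x|M. norm (\<alpha> ^ k * g k x))" for k
      proof -
        have "(LINT x|M. norm (indicator B x * (\<alpha> ^ k * g k x))) \<le> (LINT x|M. norm (\<alpha> ^ k * g k x))"
          using integrable_norm[OF iB[of k]] integrable_norm[OF integrable_mult_right[OF g_int[of k], of "\<alpha> ^ k"]]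
          by (intro integral_mono) (auto simp: indicator_def)
        then show ?thesis by simp
      qed
    qed
    from sums_integral[OF iB sB this]
    have "(\<lambda>k. LINT x|M. indicator B x * (\<alpha> ^ k * g k x))
        sums (LINT x|M. (\<Sum>k. indicator B x * (\<alpha> ^ k * g k x)))" .
    moreover have "(LINT x|M. (\<Sum>k. indicator B x * (\<alpha> ^ k * g k x))) = (LINT x:B|M. u x)"
      unfolding set_lebesgue_integral_def u_def
      by (intro Bochner_Integration.integral_cong) (auto simp: indicator_def)
    moreover have "(LINT x|M. indicator B x * (\<alpha> ^ k * g k x)) = \<alpha> ^ k * (LINT x:B|M. g k x)" for k
      unfolding set_lebesgue_integral_def
      by (subst Bochner_Integration.integral_mult_right_zero[symmetric])
        (auto intro!: Bochner_Integration.integral_cong simp: mult.left_commute)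
    ultimately show ?thesis by simp
  qed
  have u_eq: "AE x in M. u x - \<alpha> * P u x = f0 x"
  proof (rule density_unique_real)
    show "integrable M (\<lambda>x. u x - \<alpha> * P u x)"
      by (rule L2_integrable[OF residual_L2[OF uL]])
    show "integrable M f0" by (rule L2_integrable[OF f0])
    fix A assume A: "A \<in> sets M"
    let ?a = "\<lambda>k. \<alpha> ^ k * (LINT x:A|M. g k x)"
    \<comment> \<open>Passing to the preimage under \<open>S\<close> raises the index by one, since
      \<open>g (Suc k)\<close> is \<open>P (g k)\<close>.\<close>
    have shift: "(LINT x:(S -` A \<inter> space M)|M. g k x) = (LINT x:A|M. g (Suc k) x)" for k
      using set_integral_P[OF g_int[of k] A] by (simp add: g_def)
    have "(\<lambda>k. \<alpha> * (\<alpha> ^ k * (LINT x:(S -` A \<inter> space M)|M. g k x)))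
        sums (\<alpha> * (LINT x:(S -` A \<inter> space M)|M. u x))"
      by (intro sums_mult term_by_term vimage_S_sets A)
    \<comment> \<open>The extra factor \<alpha> completes the power, so this is the series for
      \<open>u\<close> over \<open>A\<close> without its term of index 0, which is the integral of
      \<open>f0\<close> over \<open>A\<close>.\<close>
    then have "(\<lambda>k. ?a (Suc k)) sums (\<alpha> * (LINT x:A|M. P u x))"
      unfolding shift set_integral_P[OF u_int A] by (simp add: mult.assoc)
    then have "?a sums (\<alpha> * (LINT x:A|M. P u x) + ?a 0)"
      by (rule sums_Suc)
    \<comment> \<open>Both limits belong to the same series, so they agree.\<close>
    from sums_unique2[OF this term_by_term[OF A]]
    have *: "(LINT x:A|M. u x) = \<alpha> * (LINT x:A|M. P u x) + (LINT x:A|M. f0 x)"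
      by (simp add: g_def)
    have set_int: "set_integrable M A h" if "integrable M h" for h :: "'a \<Rightarrow> real"
      unfolding set_integrable_def using integrable_mult_indicator[OF A that] .
    have "(LINT x:A|M. u x - \<alpha> * P u x) = (LINT x:A|M. u x) - (LINT x:A|M. \<alpha> * P u x)"
      by (intro set_integral_diff set_int u_int integrable_mult_right P_integrable)
    with * show "(LINT x:A|M. u x - \<alpha> * P u x) = (LINT x:A|M. f0 x)"
      by simp
  qed
  have "form_b M P \<alpha> u v = form_l M f0 v" if v: "v \<in> L2 M" for v
    unfolding form_b_def form_l_def
    using u_eq residual_L2[OF uL, of \<alpha>, THEN L2_measurable] v[THEN L2_measurable] f0[THEN L2_measurable]
    by (intro integral_cong_AE) auto
  with uL show ?thesis by (auto simp: weak_solution_def)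
qed

end

section \<open>The variational problem on a bounded Borel set\<close>

theorem theorem1:
  fixes \<Omega> :: "(real ^ 'n) set"
    and S :: "real ^ 'n \<Rightarrow> real ^ 'n"
    and P :: "(real ^ 'n \<Rightarrow> real) \<Rightarrow> real ^ 'n \<Rightarrow> real"
    and f0 :: "real ^ 'n \<Rightarrow> real"
    and \<alpha> :: real
    and M :: "(real ^ 'n) measure"
  defines "M \<equiv> lebesgue_on_borel \<Omega>"
  assumes "\<Omega> \<in> sets borel" and "bounded \<Omega>"
    and "nonsingular_map M S"
    and "perron_frobenius_operator M S P"
    and "nonexpansive_L2 M P"
    and "0 < \<alpha>" and "\<alpha> < 1"
    and "f0 \<in> L2 M" and "AE x in M. 0 \<le> f0 x"
  shows "(\<forall>u\<in>L2 M. \<forall>v\<in>L2 M.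
            \<bar>form_b M P \<alpha> u v\<bar> \<le> (1 + \<alpha>) * L2_norm M u * L2_norm M v)
       \<and> (\<forall>v\<in>L2 M. \<bar>form_l M f0 v\<bar> \<le> L2_norm M f0 * L2_norm M v)
       \<and> (\<forall>u\<in>L2 M. form_b M P \<alpha> u u \<ge> (1 - \<alpha>) * (L2_norm M u)\<^sup>2)
       \<and> (\<exists>u. weak_solution M P \<alpha> f0 u \<and>
              (\<forall>w. weak_solution M P \<alpha> f0 w \<longrightarrow> (AE x in M. w x = u x)))"
proof -
  \<comment> \<open>Boundedness of \<Omega> enters here, as finite Lebesgue measure.\<close>
  have fin: "finite_measure M"
  proof (rule finite_measureI)
    have "emeasure M (space M) = emeasure lborel \<Omega>"
      using assms(2) by (simp add: M_def lebesgue_on_borel_def emeasure_restrict_space space_restrict_space)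
    then show "emeasure M (space M) \<noteq> \<infinity>"
      using emeasure_bounded_finite[OF \<open>bounded \<Omega>\<close>] by simp
  qed
  interpret nonexpansive_perron_frobenius M S P
    using fin assms(4-6)
    by (simp add: nonexpansive_perron_frobenius_def nonexpansive_perron_frobenius_axioms_def)
  have \<alpha>: "0 \<le> \<alpha>" "\<alpha> < 1" using assms(7,8) by auto
  obtain u where u: "weak_solution M P \<alpha> f0 u"
    using weak_solution_exists[OF \<alpha> \<open>f0 \<in> L2 M\<close>] by blast
  have "\<bar>form_l M f0 v\<bar> \<le> L2_norm M f0 * L2_norm M v" if "v \<in> L2 M" for v
    unfolding form_l_def by (rule L2_Cauchy_Schwarz[OF \<open>f0 \<in> L2 M\<close> that])
  then show ?thesis
    using form_b_bounded[OF _ _ \<alpha>(1)] form_b_coercive[OF _ \<alpha>(1)] u weak_solution_unique[OF \<alpha> u]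
    by blast
qed

end
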